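(* Let $\mathfrak{q}\in\mathbb{R}$ and let $s(\mathfrak{w})=\sqrt{1+\mathfrak{q}^2-\mathfrak{w}^2}$ denote the principal branch ($\operatorname{Re}s>0$), for $\mathfrak{w}$ in $\mathbb{C}$ minus the cuts $\{\mathfrak{w}\in\mathbb{R}:\mathfrak{w}^2\ge 1+\mathfrak{q}^2\}$. For $\epsilon\in\{+1,-1\}$ consider the shear-channel quasinormal-mode conditions $$\frac{-1+\epsilon s(\mathfrak{w})-i\mathfrak{w}}{2}\in\{0,-1,-2,\dots\}\quad\text{or}\quad \frac{3+\epsilon s(\mathfrak{w})-i\mathfrak{w}}{2}\in\{0,-1,-2,\dots\}.$$ (i) On the first sheet ($\epsilon=+1$) the only solution is the hydrodynamic (shear diffusion) mode $\mathfrak{w}=-i\mathfrak{q}^2/2$, for which $\frac{-1+s-i\mathfrak{w}}{2}=0$. (ii) On the second sheet ($\epsilon=-1$) the set of solutions is exactly $$\Big\{\mathfrak{w}_n=-2i\,\frac{n(n+1)}{2n+1}+i\,\frac{\mathfrak{q}^2}{2(2n+1)}\ :\ n=0,1,2,\dots\Big\}.$$ In particular, all solutions with $\operatorname{Im}\mathfrak{w}>0$ are on the second sheet.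
   Context: The conditions are $a=-n$ or $b=-n$ ($n=0,1,2,\dots$) for the parameters $a=\frac{-1+s-i\mathfrak{w}}{2}$, $b=\frac{3+s-i\mathfrak{w}}{2}$, $c=1+s$ of the hypergeometric equation to which the equations for the shear metric fluctuations $H_{tx}'$ and $H_{zx}'$ of the linear dilaton black hole reduce. "First sheet" means $\operatorname{Re}\sqrt{1+\mathfrak{q}^2-\mathfrak{w}^2}>0$ and "second sheet" means the opposite sign of the square root. *)

theory Defs
  imports Complex_Main "HOL-Library.Nonpos_Ints"
begin

definition branch_cuts :: "real \<Rightarrow> complex set" where
  "branch_cuts q = complex_of_real ` {x. x\<^sup>2 \<ge> 1 + q\<^sup>2}"

definition shear_s :: "real \<Rightarrow> complex \<Rightarrow> complex" where
  "shear_s q w = csqrt (1 + (complex_of_real q)\<^sup>2 - w\<^sup>2)"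

text \<open>
  The parameter \<open>\<epsilon>\<close> is the sign of the square root: \<open>\<epsilon> = 1\<close> is the first sheet and
  \<open>\<epsilon> = -1\<close> the second one.  The functions \<open>shear_a\<close> and \<open>shear_b\<close> are the first two
  parameters of the hypergeometric equation (the third one is \<open>1 + \<epsilon> * shear_s q w\<close>).
\<close>

definition shear_a :: "real \<Rightarrow> real \<Rightarrow> complex \<Rightarrow> complex" where
  "shear_a \<epsilon> q w = (-1 + complex_of_real \<epsilon> * shear_s q w - \<i> * w) / 2"

definition shear_b :: "real \<Rightarrow> real \<Rightarrow> complex \<Rightarrow> complex" where
  "shear_b \<epsilon> q w = (3 + complex_of_real \<epsilon> * shear_s q w - \<i> * w) / 2"

definition shear_QNM :: "real \<Rightarrow> real \<Rightarrow> complex set" where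
  "shear_QNM \<epsilon> q = {w. w \<notin> branch_cuts q \<and>
     (shear_a \<epsilon> q w \<in> \<int>\<^sub>\<le>\<^sub>0 \<or> shear_b \<epsilon> q w \<in> \<int>\<^sub>\<le>\<^sub>0)}"

text \<open>
  The library's \<open>csqrt\<close> is total, with \<open>Re (csqrt z) = 0\<close> for \<open>z\<close> real and nonpositive.
  Off the cuts it is the branch with positive real part:
\<close>

lemma Re_shear_s_pos:
  assumes "w \<notin> branch_cuts q"
  shows "Re (shear_s q w) > 0"
proof (rule ccontr)
  assume "\<not> Re (shear_s q w) > 0"
  then have R: "Re (shear_s q w) = 0"
    using csqrt_principal[of "1 + (complex_of_real q)\<^sup>2 - w\<^sup>2"]
    unfolding shear_s_def by linarith
  have sq: "(shear_s q w)\<^sup>2 = 1 + (complex_of_real q)\<^sup>2 - w\<^sup>2"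
    by (simp add: shear_s_def)
  have re: "- (Im (shear_s q w))\<^sup>2 = 1 + q\<^sup>2 - (Re w)\<^sup>2 + (Im w)\<^sup>2"
    using arg_cong[OF sq, of Re] R by (simp add: power2_eq_square)
  have im: "Re w * Im w = 0"
    using arg_cong[OF sq, of Im] R by (auto simp add: power2_eq_square)
  have "Re w \<noteq> 0"
  proof
    assume "Re w = 0"
    then show False
      using re zero_le_power2[of "Im (shear_s q w)"] zero_le_power2[of q]
        zero_le_power2[of "Im w"] by simp
  qed
  with im have I: "Im w = 0" by simp
  then have "(Re w)\<^sup>2 \<ge> 1 + q\<^sup>2"
    using re zero_le_power2[of "Im (shear_s q w)"] unfolding I power_zero_numeral by linarith
  moreover have "w = complex_of_real (Re w)"
    using I by (simp add: complex_eq_iff)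
  ultimately show False
    using assms unfolding branch_cuts_def by blast
qed

end

(*
  Write the condition on the first parameter as \<epsilon> s = \<i> w + m with m = 1 - 2 n odd; the condition on the
  second parameter is the same one with n replaced by n + 2, hence it adds nothing.  Squaring
  cancels w\<^sup>2, so each m gives exactly one candidate, w = \<i> (m\<^sup>2 - 1 - q\<^sup>2) / (2 m), for which
  \<epsilon> s = (1 + q\<^sup>2 + m\<^sup>2) / (2 m).  As Re s > 0, the candidate lies on the sheet given by the sign of m;
  the only positive m is 1.
*)
theory Submission imports Defs begin

text \<open>The factor \<open>\<i>\<close> is kept apart from a real coefficient: the candidate is
  then visibly purely imaginary, hence off the cuts, and the sheet conditions become equations
  between reals.\<close>

definition shear_root :: "real \<Rightarrow> real \<Rightarrow> complex" where
  "shear_root q m = \<i> * complex_of_real ((m\<^sup>2 - 1 - q\<^sup>2) / (2 * m))"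

lemma imaginary_notin_branch_cuts: "\<i> * complex_of_real y \<notin> branch_cuts q"
proof
  assume "\<i> * complex_of_real y \<in> branch_cuts q"
  then obtain x where x: "x\<^sup>2 \<ge> 1 + q\<^sup>2" "\<i> * complex_of_real y = complex_of_real x"
    unfolding branch_cuts_def by blast
  from arg_cong[OF x(2), of Re] have "x = 0" by simp
  with x(1) show False using zero_le_power2[of q] by simp
qed

text \<open>At the candidate the radicand is a perfect square of a real number. The absolute value
  selects the positive one of its two roots, which is the principal value.\<close>

lemma shear_s_root:
  assumes "m \<noteq> 0"
  shows "shear_s q (shear_root q m) = complex_of_real ((1 + q\<^sup>2 + m\<^sup>2) / (2 * \<bar>m\<bar>))"
proof -
  define r where "r = (1 + q\<^sup>2 + m\<^sup>2) / (2 * \<bar>m\<bar>)"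
  \<comment> \<open>This is (A + B)^2 = 4 A B + (B - A)^2 with A = 1 + q^2 and B = m^2. The 4 stays
    in the form \<open>2\<^sup>2\<close> to match the expanded square of the denominator of
    \<open>r\<close>.\<close>
  have "(1 + q\<^sup>2 + m\<^sup>2)\<^sup>2 = (1 + q\<^sup>2) * (2\<^sup>2 * m\<^sup>2) + (m\<^sup>2 - 1 - q\<^sup>2)\<^sup>2"
    by algebra
  then have "r\<^sup>2 = 1 + q\<^sup>2 + ((m\<^sup>2 - 1 - q\<^sup>2) / (2 * m))\<^sup>2"
    using assms unfolding r_def power_divide power_mult_distrib power2_abs
    by (simp only: add_divide_distrib) simp
  from arg_cong[OF this, of complex_of_real]
  have "1 + (complex_of_real q)\<^sup>2 - (shear_root q m)\<^sup>2 = (complex_of_real r)\<^sup>2"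
    unfolding shear_root_def power_mult_distrib by simp
  moreover have "r > 0"
    using assms unfolding r_def by (intro divide_pos_pos add_pos_nonneg) auto
  ultimately show ?thesis
    unfolding shear_s_def r_def[symmetric] by (simp add: csqrt_square)
qed

lemma i_times_shear_root_plus:
  "\<i> * shear_root q m + complex_of_real m = complex_of_real (m - (m\<^sup>2 - 1 - q\<^sup>2) / (2 * m))"
proof -
  have "\<i> * (\<i> * complex_of_real x) + complex_of_real m = complex_of_real (m - x)" for x
    by simp
  then show ?thesis
    unfolding shear_root_def .
qed

text \<open>Squaring fixes w but forgets the sign of the root. The sign is recovered by inserting
  the candidate into the unsquared equation, where the two sides differ only by having
  \<open>\<epsilon> / \<bar>m\<bar>\<close> in place of \<open>1 / m\<close>.\<close>

lemma sheet_condition_iff: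
  assumes "\<epsilon> = 1 \<or> \<epsilon> = -1" "m \<noteq> 0"
  shows "w \<notin> branch_cuts q \<and> complex_of_real \<epsilon> * shear_s q w = \<i> * w + complex_of_real m
    \<longleftrightarrow> \<epsilon> * m > 0 \<and> w = shear_root q m" (is "?L \<longleftrightarrow> ?R")
proof
  assume L: ?L
  have "(shear_s q w)\<^sup>2 = (complex_of_real \<epsilon> * shear_s q w)\<^sup>2"
    using assms(1) by auto
  then have "1 + (complex_of_real q)\<^sup>2 - w\<^sup>2 = (\<i> * w + complex_of_real m)\<^sup>2"
    using L by (simp add: shear_s_def)
  then have "1 + (complex_of_real q)\<^sup>2 - (complex_of_real m)\<^sup>2 = 2 * \<i> * complex_of_real m * w"
    by (simp add: power2_sum power_mult_distrib algebra_simps)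
  \<comment> \<open>Multiplying by \<open>- \<i>\<close> turns the right-hand side into 2 m w, so
    that only a division by 2 m remains.\<close>
  from arg_cong[OF this, of "\<lambda>z. - \<i> * z"] have w: "w = shear_root q m"
    using assms(2) by (simp add: shear_root_def field_simps)
  have "\<epsilon> * ((1 + q\<^sup>2 + m\<^sup>2) / (2 * \<bar>m\<bar>)) = m - (m\<^sup>2 - 1 - q\<^sup>2) / (2 * m)"
    using conjunct2[OF L] unfolding w shear_s_root[OF assms(2)] i_times_shear_root_plus
    by (simp only: of_real_eq_iff flip: of_real_mult)
  also have "\<dots> = (1 + q\<^sup>2 + m\<^sup>2) / (2 * m)"
    using assms(2) by (simp add: field_simps power2_eq_square)
  \<comment> \<open>Cancelling the positive common factor will leave
    \<open>\<epsilon> * m = \<bar>m\<bar>\<close>, which is positive.\<close>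
  finally have "(1 + q\<^sup>2 + m\<^sup>2) * (\<epsilon> * m) = (1 + q\<^sup>2 + m\<^sup>2) * \<bar>m\<bar>"
    using assms(2) by (simp add: field_simps)
  moreover have "1 + q\<^sup>2 + m\<^sup>2 > 0"
    by (intro add_pos_nonneg) auto
  ultimately have "\<epsilon> * m > 0"
    using assms(2) by simp
  with w show ?R by blast
next
  assume R: ?R
  then have "\<epsilon> = sgn m"
    using assms by (auto simp: sgn_if)
  then have "\<epsilon> * ((1 + q\<^sup>2 + m\<^sup>2) / (2 * \<bar>m\<bar>)) = m - (m\<^sup>2 - 1 - q\<^sup>2) / (2 * m)"
    using assms(2) by (simp add: sgn_if field_simps power2_eq_square)
  then have "complex_of_real \<epsilon> * shear_s q w = complex_of_real (m - (m\<^sup>2 - 1 - q\<^sup>2) / (2 * m))"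
    using R shear_s_root[OF assms(2)] by (metis of_real_mult)
  moreover have "w \<notin> branch_cuts q"
    using R imaginary_notin_branch_cuts by (metis shear_root_def)
  ultimately show ?L
    using R i_times_shear_root_plus[of q m] by simp
qed

lemma nonpos_Ints_iff_of_nat: "z \<in> \<int>\<^sub>\<le>\<^sub>0 \<longleftrightarrow> (\<exists>n. z = - of_nat n)"
  by (auto elim: nonpos_Ints_cases')

lemma shear_b_eq: "shear_b \<epsilon> q w = shear_a \<epsilon> q w + 2"
  by (simp add: shear_a_def shear_b_def field_simps)

lemma shear_a_or_b_nonpos_Ints_iff:
  "shear_a \<epsilon> q w \<in> \<int>\<^sub>\<le>\<^sub>0 \<or> shear_b \<epsilon> q w \<in> \<int>\<^sub>\<le>\<^sub>0 \<longleftrightarrow>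
    (\<exists>n. complex_of_real \<epsilon> * shear_s q w = \<i> * w + complex_of_real (1 - 2 * real n))"
proof -
  have "shear_a \<epsilon> q w \<in> \<int>\<^sub>\<le>\<^sub>0" if "shear_b \<epsilon> q w = - of_nat n" for n
  proof -
    have "shear_a \<epsilon> q w = - of_nat (n + 2)"
      using that unfolding shear_b_eq by (simp add: algebra_simps eq_diff_eq)
    then show ?thesis
      unfolding nonpos_Ints_iff_of_nat by blast
  qed
  then have "shear_a \<epsilon> q w \<in> \<int>\<^sub>\<le>\<^sub>0 \<or> shear_b \<epsilon> q w \<in> \<int>\<^sub>\<le>\<^sub>0 \<longleftrightarrow> (\<exists>n. shear_a \<epsilon> q w = - of_nat n)"
    unfolding nonpos_Ints_iff_of_nat by blast
  moreover have "shear_a \<epsilon> q w = - of_nat n \<longleftrightarrow>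
      complex_of_real \<epsilon> * shear_s q w = \<i> * w + complex_of_real (1 - 2 * real n)" for n
    by (auto simp: shear_a_def field_simps)
  ultimately show ?thesis by simp
qed

lemma shear_QNM_eq:
  assumes "\<epsilon> = 1 \<or> \<epsilon> = -1"
  shows "shear_QNM \<epsilon> q = {shear_root q (1 - 2 * real n) | n. \<epsilon> * (1 - 2 * real n) > 0}"
proof -
  \<comment> \<open>By parity: otherwise 1 = 2 n in the naturals.\<close>
  have odd_nz: "1 - 2 * real n \<noteq> 0" for n
    by (metis eq_iff_diff_eq_0 of_nat_1 of_nat_eq_iff of_nat_mult of_nat_numeral odd_one dvd_triv_left)
  show ?thesis
    unfolding shear_QNM_def shear_a_or_b_nonpos_Ints_iff
    using sheet_condition_iff[OF assms odd_nz] by blast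
qed

lemma shear_QNM_first_sheet: "shear_QNM 1 q = {- \<i> * (complex_of_real q)\<^sup>2 / 2}"
proof -
  have "0 < 1 * (1 - 2 * real n) \<longleftrightarrow> n = 0" for n
    by (cases n) auto
  then show ?thesis
    by (simp add: shear_QNM_eq shear_root_def)
qed

text \<open>Here m runs through -1, -3, -5, and so on. The index 0 of \<open>shear_QNM_eq\<close>
  has m = 1 and drops out, so the numbering is shifted by one.\<close>

lemma shear_QNM_second_sheet:
  "shear_QNM (-1) q =
     {- 2 * \<i> * (of_nat n * (of_nat n + 1) / (2 * of_nat n + 1))
        + \<i> * ((complex_of_real q)\<^sup>2 / (2 * (2 * of_nat n + 1))) | n :: nat. True}"
proof -
  have root: "shear_root q (1 - 2 * real (Suc n)) =
      - 2 * \<i> * (of_nat n * (of_nat n + 1) / (2 * of_nat n + 1))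
        + \<i> * ((complex_of_real q)\<^sup>2 / (2 * (2 * of_nat n + 1)))" for n
  proof -
    \<comment> \<open>\<open>d\<close> is the absolute value of m; dividing d^2 - 1 = 4 n (n + 1) by
      2 d yields the first term of the formula.\<close>
    define d where "d = 2 * real n + 1"
    have "d > 0" by (simp add: d_def)
    have "1 - 2 * real (Suc n) = - d" "real n * (real n + 1) = (d\<^sup>2 - 1) / 4"
      by (simp_all add: d_def power2_eq_square field_simps)
    moreover have "((- d)\<^sup>2 - 1 - q\<^sup>2) / (2 * - d) = - 2 * ((d\<^sup>2 - 1) / 4 / d) + q\<^sup>2 / (2 * d)"
      using \<open>d > 0\<close> by (simp add: field_simps)
    ultimately have "shear_root q (1 - 2 * real (Suc n)) =
        \<i> * complex_of_real (- 2 * (real n * (real n + 1) / (2 * real n + 1)) + q\<^sup>2 / (2 * (2 * real n + 1)))"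
      by (simp only: shear_root_def d_def)
    also have "\<dots> = - 2 * \<i> * (of_nat n * (of_nat n + 1) / (2 * of_nat n + 1))
        + \<i> * ((complex_of_real q)\<^sup>2 / (2 * (2 * of_nat n + 1)))"
      by (simp add: algebra_simps)
    finally show ?thesis .
  qed
  have pos: "- 1 * (1 - 2 * real n) > 0 \<longleftrightarrow> (\<exists>k. n = Suc k)" for n
    by (cases n) auto
  have "shear_QNM (-1) q = {shear_root q (1 - 2 * real (Suc k)) | k. True}"
    unfolding shear_QNM_eq[OF disjI2[OF refl]] pos by blast
  then show ?thesis
    unfolding root .
qed

theorem mainTheorem3:
  fixes q :: real
  shows "shear_QNM 1 q = {- \<i> * (complex_of_real q)\<^sup>2 / 2} \<and>
     shear_a 1 q (- \<i> * (complex_of_real q)\<^sup>2 / 2) = 0 \<and>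
     shear_QNM (-1) q =
       {- 2 * \<i> * (of_nat n * (of_nat n + 1) / (2 * of_nat n + 1))
          + \<i> * ((complex_of_real q)\<^sup>2 / (2 * (2 * of_nat n + 1))) | n :: nat. True} \<and>
     (\<forall>\<epsilon>\<in>{1, -1}. \<forall>w\<in>shear_QNM \<epsilon> q. Im w > 0 \<longrightarrow> \<epsilon> = -1)"
proof (intro conjI)
  \<comment> \<open>For m = 1 the square root is 1 + q^2/2 and \<open>\<i> * w\<close> equals q^2/2,
    so the numerator of \<open>shear_a\<close> cancels.\<close>
  have "shear_root q 1 = - \<i> * (complex_of_real q)\<^sup>2 / 2"
    by (simp add: shear_root_def)
  then show "shear_a 1 q (- \<i> * (complex_of_real q)\<^sup>2 / 2) = 0"
    using shear_s_root[of 1 q] by (simp only: shear_a_def) (simp add: field_simps)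
  \<comment> \<open>The only mode on the first sheet has imaginary part - q^2/2.\<close>
  have "\<not> Im w > 0" if "w \<in> shear_QNM 1 q" for w
    using that unfolding shear_QNM_first_sheet
    by (auto simp flip: of_real_power)
  then show "\<forall>\<epsilon>\<in>{1, -1}. \<forall>w\<in>shear_QNM \<epsilon> q. Im w > 0 \<longrightarrow> \<epsilon> = -1"
    by blast
qed (rule shear_QNM_first_sheet shear_QNM_second_sheet)+

end
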